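(* Let $a<b$ be real numbers and let $f:[a,b]\to\mathbb{R}$ be a convex function on $[a,b]$. Then $$0\le\frac18\left[f'_+\left(\frac{a+b}2\right)-f'_-\left(\frac{a+b}2\right)\right](b-a)\le\frac{f(a)+f(b)}2-\frac1{b-a}\int_a^b f(t)\,dt .$$ The constant $\frac18$ is sharp, i.e., it cannot be replaced by a larger constant so that the second inequality still holds for all convex $f:[a,b]\to\mathbb{R}$.
   Context: $f'_+$ and $f'_-$ denote the right and left derivatives of $f$. *)

theory Defs
  imports "HOL-Analysis.Analysis"
begin

(* One-sided derivatives; unspecified where the one-sided limit of difference quotients
   does not exist.  For a convex function they exist at every interior point. *)

definition right_deriv :: "(real \<Rightarrow> real) \<Rightarrow> real \<Rightarrow> real" where
  "right_deriv f x = (THE D. (f has_real_derivative D) (at_right x))"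

definition left_deriv :: "(real \<Rightarrow> real) \<Rightarrow> real \<Rightarrow> real" where
  "left_deriv f x = (THE D. (f has_real_derivative D) (at_left x))"

end

theory Submission imports Defs
begin

text \<open>Let \<open>m\<close> be the midpoint. Bounding \<open>f\<close> by its chords on the two halves \<open>[a,m]\<close> and \<open>[m,b]\<close>
  shows that the right-hand side is at least \<open>(f a + f b)/4 - f m/2\<close>. The support lines at \<open>m\<close> with
  slopes \<open>f'\<^sub>+(m)\<close> and \<open>f'\<^sub>-(m)\<close> bound \<open>f b\<close> and \<open>f a\<close> from below, and this turns the last quantity
  into the left-hand side. Both estimates are equalities for \<open>f t = \<bar>t - m\<bar>\<close>.\<close>

section \<open>One-sided derivatives and support lines of convex functions\<close>

lemma right_deriv_eqI:
  assumes "(f has_real_derivative D) (at_right x)"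
  shows "right_deriv f x = D"
  unfolding right_deriv_def using assms
  by (auto simp: has_field_derivative_iff intro: tendsto_unique[OF trivial_limit_at_right_real])

lemma left_deriv_eqI:
  assumes "(f has_real_derivative D) (at_left x)"
  shows "left_deriv f x = D"
  unfolding left_deriv_def using assms
  by (auto simp: has_field_derivative_iff intro: tendsto_unique[OF trivial_limit_at_left_real])

text \<open>Reflection swaps the one-sided filters and flips the sign of the difference quotient.
  Left derivatives thus reduce to right ones.\<close>

lemma has_right_derivative_mirror:
  fixes f :: "real \<Rightarrow> real"
  assumes "((\<lambda>t. f (- t)) has_real_derivative D) (at_right (- x))"
  shows "(f has_real_derivative - D) (at_left x)"
proof -
  have "((\<lambda>y. (f (- y) - f x) / (y + x)) \<longlongrightarrow> D) (at_right (- x))"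
    using assms by (simp add: has_field_derivative_iff)
  then have "((\<lambda>y. - ((f (- y) - f x) / (y + x))) \<longlongrightarrow> - D) (at_right (- x))"
    by (rule tendsto_minus)
  moreover have "- ((f (- y) - f x) / (y + x)) = (f (- y) - f x) / (- y - x)" for y
    by (metis minus_add_distrib minus_divide_right diff_conv_add_uminus)
  ultimately show ?thesis
    by (simp add: has_field_derivative_iff filterlim_at_left_to_right)
qed

lemma convex_on_mirror:
  fixes f :: "real \<Rightarrow> real"
  assumes "convex_on {a..b} f"
  shows "convex_on {- b..- a} (\<lambda>t. f (- t))"
proof (rule convex_onI)
  fix t x y :: real
  assume "0 < t" "t < 1" "x \<in> {- b..- a}" "y \<in> {- b..- a}"
  then show "f (- ((1 - t) *\<^sub>R x + t *\<^sub>R y)) \<le> (1 - t) * f (- x) + t * f (- y)"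
    using convex_onD[OF assms, of t "- x" "- y"] by (simp add: algebra_simps)
qed simp

text \<open>Slopes of chords from \<open>x\<close> increase with the other end, so their limit from
  the right is their infimum over points right of \<open>x\<close>. It lies above every slope to the
  left and below every slope to the right, which is the support line property.\<close>

lemma convex_on_has_right_derivative:
  fixes f :: "real \<Rightarrow> real"
  assumes f: "convex_on {a..b} f" and x: "a < x" "x < b"
  obtains D where "(f has_real_derivative D) (at_right x)"
    and "\<And>y. y \<in> {a..b} \<Longrightarrow> f x + D * (y - x) \<le> f y"
proof -
  define q where "q y = (f y - f x) / (y - x)" for y
  define D where "D = (INF y\<in>{x<..b}. q y)"
  have q_alt: "q y = (f x - f y) / (x - y)" for y
    unfolding q_def by (metis minus_diff_eq minus_divide_divide)
  have q_mono: "q y \<le> q z" if "x < y" "y \<le> z" "z \<le> b" for y z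
    using convex_on_slope_le(1)[OF f, of x z y] that x
    by (cases "y = z") (auto simp: q_alt)
  \<comment> \<open>Both slopes are compared with that of the chord from \<open>y\<close> to
    \<open>z\<close>, whose ends lie on either side of \<open>x\<close>.\<close>
  have q_left: "q y \<le> q z" if "a \<le> y" "y < x" "x < z" "z \<le> b" for y z
    unfolding q_def[of y] q_alt[of z]
    using that x by (intro order_trans[OF convex_on_slope_le[OF f, of y z x]]) auto
  \<comment> \<open>The point \<open>a\<close> to the left of \<open>x\<close> keeps the infimum
    finite; at a left endpoint it may be infinite, as for \<open>- sqrt t\<close> at 0.\<close>
  have bdd: "bdd_below (q ` {x<..b})"
    using q_left[of a] x by (intro bdd_belowI2[of _ "q a"]) auto
  have D_le: "D \<le> q z" if "x < z" "z \<le> b" for z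
    unfolding D_def using that by (intro cINF_lower bdd) auto
  have D_ge: "q y \<le> D" if "a \<le> y" "y < x" for y
    unfolding D_def using that x q_left by (intro cINF_greatest) auto
  have near: "eventually (\<lambda>y. y \<in> {x<..<c}) (at_right x)" if "x < c" for c
    using that by (rule eventually_at_right_real)
  have "(q \<longlongrightarrow> D) (at_right x)"
  proof (rule order_tendstoI)
    fix l assume "l < D"
    from near[OF x(2)] show "\<forall>\<^sub>F y in at_right x. l < q y"
      by eventually_elim (use D_le \<open>l < D\<close> in force)
  next
    fix u assume "D < u"
    \<comment> \<open>Some slope is already below \<open>u\<close>; by monotonicity so are all
      slopes to points between \<open>x\<close> and \<open>z\<close>.\<close>
    then obtain z where z: "x < z" "z \<le> b" "q z < u"
      unfolding D_def using bdd x by (subst (asm) cINF_less_iff) auto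
    from near[OF z(1)] show "\<forall>\<^sub>F y in at_right x. q y < u"
    proof eventually_elim
      case (elim y)
      with q_mono[of y z] z show ?case by simp
    qed
  qed
  then have "(f has_real_derivative D) (at_right x)"
    by (simp add: has_field_derivative_iff q_def[abs_def])
  moreover have "f x + D * (y - x) \<le> f y" if "y \<in> {a..b}" for y
  \<comment> \<open>For \<open>y < x\<close> the factor \<open>y - x\<close> is negative and
    reverses the slope bound, so both sides of \<open>x\<close> give the same inequality.\<close>
  proof (cases y x rule: linorder_cases)
    case less
    with D_ge[of y] that show ?thesis by (simp add: q_def neg_divide_le_eq)
  next
    case greater
    with D_le[of y] that show ?thesis by (simp add: q_def pos_le_divide_eq)
  qed simp
  ultimately show thesis by (rule that)
qed

text \<open>Obtained by reflecting \<open>f\<close>: the slope changes sign together with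
  \<open>y - x\<close>, so the support inequality keeps its form.\<close>

lemma convex_on_has_left_derivative:
  fixes f :: "real \<Rightarrow> real"
  assumes f: "convex_on {a..b} f" and x: "a < x" "x < b"
  obtains D where "(f has_real_derivative D) (at_left x)"
    and "\<And>y. y \<in> {a..b} \<Longrightarrow> f x + D * (y - x) \<le> f y"
proof -
  obtain D where D: "((\<lambda>t. f (- t)) has_real_derivative D) (at_right (- x))"
    and supp: "\<And>y. y \<in> {- b..- a} \<Longrightarrow> f (- (- x)) + D * (y - - x) \<le> f (- y)"
    using convex_on_has_right_derivative[OF convex_on_mirror[OF f], of "- x"] x by auto
  have "f x + - D * (y - x) \<le> f y" if "y \<in> {a..b}" for y
    using supp[of "- y"] that by (simp add: algebra_simps)
  with has_right_derivative_mirror[OF D] show thesis by (rule that)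
qed

section \<open>Boundedness and integrability\<close>

lemma convex_on_bounded:
  fixes f :: "real \<Rightarrow> real"
  assumes f: "convex_on {a..b} f"
  obtains B where "\<And>x. x \<in> {a..b} \<Longrightarrow> \<bar>f x\<bar> \<le> B"
proof -
  define M where "M = max (f a) (f b)"
  define m where "m = (a + b) / 2"
  have upper: "f x \<le> M" if "x \<in> {a..b}" for x
  proof -
    have "convex hull {a, b} = {a..b}"
      using that by (simp flip: segment_convex_hull add: closed_segment_eq_real_ivl)
    then show ?thesis
      using convex_on_convex_hull_bound[of "{a, b}" f M] f that by (auto simp: M_def)
  qed
  \<comment> \<open>The midpoint \<open>m\<close> lies halfway between \<open>x\<close> and its
    reflection \<open>a + b - x\<close>, where \<open>f\<close> is at most \<open>M\<close>.\<close>
  have lower: "2 * f m - M \<le> f x" if "x \<in> {a..b}" for x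
  proof -
    have "a + b - x \<in> {a..b}" using that by auto
    with convex_onD[OF f, of "1/2" x "a + b - x"] that upper[of "a + b - x"]
    show ?thesis by (simp add: m_def field_simps)
  qed
  show thesis
  proof (rule that)
    show "\<bar>f x\<bar> \<le> max \<bar>M\<bar> \<bar>2 * f m - M\<bar>" if "x \<in> {a..b}" for x
      using upper[OF that] lower[OF that] by linarith
  qed
qed

text \<open>Convexity gives continuity only in the interior; at the endpoints \<open>f\<close> may jump.\<close>

lemma convex_on_integrable_on:
  fixes f :: "real \<Rightarrow> real"
  assumes f: "convex_on {a..b} f"
  shows "f integrable_on {a..b}"
proof -
  obtain B where B: "\<And>x. x \<in> {a..b} \<Longrightarrow> \<bar>f x\<bar> \<le> B"
    using convex_on_bounded[OF f] by blast
  have "convex_on {a<..<b} f"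
    using f by (rule convex_on_subset) auto
  then have "continuous_on {a<..<b} f"
    by (intro convex_on_continuous) auto
  then have "f \<in> borel_measurable (lebesgue_on {a<..<b})"
    by (rule continuous_imp_measurable_on_sets_lebesgue) auto
  moreover have "(\<lambda>_. B) integrable_on {a<..<b}"
    by (metis integrable_const_ivl integrable_on_Icc_iff_Ioo)
  \<comment> \<open>A measurable function dominated by an integrable constant; the two endpoints do
    not affect integrability.\<close>
  ultimately have "f integrable_on {a<..<b}"
    by (rule measurable_bounded_by_integrable_imp_integrable) (auto intro: B)
  then show ?thesis by (simp add: integrable_on_Icc_iff_Ioo)
qed

section \<open>Integrals of affine functions and the trapezoid bound\<close>

lemma has_integral_affine:
  fixes a b u v :: real
  assumes "a \<le> b"
  shows "((\<lambda>t. u + v * (t - a)) has_integral (b - a) * (u + v * (b - a) / 2)) {a..b}"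
proof -
  have "((\<lambda>t. u + v * (t - a)) has_integral
      (u * b + v * (b - a)\<^sup>2 / 2) - (u * a + v * (a - a)\<^sup>2 / 2)) {a..b}"
    using assms
    by (intro fundamental_theorem_of_calculus)
      (auto intro!: derivative_eq_intros simp flip: has_real_derivative_iff_has_vector_derivative)
  then show ?thesis by (simp add: algebra_simps power2_eq_square)
qed

lemma convex_on_integral_le_trapezoid:
  fixes f :: "real \<Rightarrow> real"
  assumes f: "convex_on {a..b} f" and "a < b"
  shows "integral {a..b} f \<le> (b - a) * (f a + f b) / 2"
proof -
  let ?g = "\<lambda>t. f a + (f b - f a) / (b - a) * (t - a)"
  have g: "(?g has_integral (b - a) * (f a + f b) / 2) {a..b}"
  proof (rule has_integral_eq_rhs[OF has_integral_affine])
    have "(f b - f a) / (b - a) * (b - a) = f b - f a" using \<open>a < b\<close> by simp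
    then show "(b - a) * (f a + f b) / 2 = (b - a) * (f a + (f b - f a) / (b - a) * (b - a) / 2)"
      by (simp only:) (simp add: field_simps)
  qed (use \<open>a < b\<close> in simp)
  have "integral {a..b} f \<le> integral {a..b} ?g"
  proof (rule integral_le)
    show "f integrable_on {a..b}" using f by (rule convex_on_integrable_on)
    show "?g integrable_on {a..b}" using g by blast
    show "f t \<le> ?g t" if "t \<in> {a..b}" for t
      using convex_onD_Icc'[OF f that] by simp
  qed
  with g show ?thesis by (simp add: integral_unique)
qed

section \<open>The inequality between the derivative jump and the trapezoid error\<close>

lemma trapezoid_error_ge_deriv_jump:
  fixes f :: "real \<Rightarrow> real"
  assumes f: "convex_on {a..b} f" and "a < b"
  defines "J \<equiv> right_deriv f ((a + b)/2) - left_deriv f ((a + b)/2)"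
  shows "0 \<le> J" and "J * (b - a) / 8 \<le> (f a + f b)/2 - 1/(b - a) * integral {a..b} f"
proof -
  define m where "m = (a + b) / 2"
  define h where "h = (b - a) / 2"
  have m: "a < m" "m < b" and h: "h > 0" "b - m = h" "a - m = - h" "m - a = h" "b - a = 2 * h"
    using \<open>a < b\<close> by (auto simp: m_def h_def field_simps)
  obtain R where R: "(f has_real_derivative R) (at_right m)"
    and supp_R: "\<And>y. y \<in> {a..b} \<Longrightarrow> f m + R * (y - m) \<le> f y"
    using convex_on_has_right_derivative[OF f m] by blast
  obtain L where L: "(f has_real_derivative L) (at_left m)"
    and supp_L: "\<And>y. y \<in> {a..b} \<Longrightarrow> f m + L * (y - m) \<le> f y"
    using convex_on_has_left_derivative[OF f m] by blast
  have J: "J = R - L"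
    using right_deriv_eqI[OF R] left_deriv_eqI[OF L] by (simp add: J_def m_def)
  \<comment> \<open>The support line of slope \<open>L\<close> forces every difference quotient to
    the right of \<open>m\<close> to be at least \<open>L\<close>; pass to the limit.\<close>
  have "L \<le> R"
  proof (rule tendsto_lowerbound)
    show "((\<lambda>y. (f y - f m) / (y - m)) \<longlongrightarrow> R) (at_right m)"
      using R by (simp add: has_field_derivative_iff)
    have "eventually (\<lambda>y. y \<in> {m<..<b}) (at_right m)"
      using m(2) by (rule eventually_at_right_real)
    then show "\<forall>\<^sub>F y in at_right m. L \<le> (f y - f m) / (y - m)"
    proof eventually_elim
      case (elim y)
      with supp_L[of y] m show ?case by (simp add: pos_le_divide_eq)
    qed
  qed simp
  then show "0 \<le> J" by (simp add: J)
  \<comment> \<open>At each endpoint the steeper of the two support lines is used: slope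
    \<open>R\<close> at \<open>b\<close>, slope \<open>L\<close> at \<open>a\<close>.\<close>
  have b_ge: "f m + R * h \<le> f b" and a_ge: "f m - L * h \<le> f a"
    using supp_R[of b] supp_L[of a] \<open>a < b\<close> by (simp_all add: h)
  have "integral {a..m} f \<le> h * (f a + f m) / 2"
    using convex_on_integral_le_trapezoid[of a m f] convex_on_subset[OF f, of "{a..m}"] m h by auto
  moreover have "integral {m..b} f \<le> h * (f m + f b) / 2"
    using convex_on_integral_le_trapezoid[of m b f] convex_on_subset[OF f, of "{m..b}"] m h by auto
  moreover have "integral {a..m} f + integral {m..b} f = integral {a..b} f"
    using m convex_on_integrable_on[OF f] by (intro Henstock_Kurzweil_Integration.integral_combine) auto
  ultimately have "integral {a..b} f \<le> h * ((f a + f b) / 2 + f m)"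
    by (simp add: algebra_simps add_divide_distrib)
  then have "1 / (b - a) * integral {a..b} f \<le> (f a + f b) / 4 + f m / 2"
    using h by (simp add: field_simps)
  \<comment> \<open>A quarter of the sum of \<open>a_ge\<close> and \<open>b_ge\<close>. Since
    \<open>h\<close> is half of \<open>b - a\<close>, this quarter becomes the constant 1/8.\<close>
  moreover have "(R * h - L * h) / 4 \<le> (f a + f b) / 4 - f m / 2"
    using a_ge b_ge by argo
  moreover have "J * (b - a) / 8 = (R * h - L * h) / 4"
    by (simp add: J h(5) field_simps)
  ultimately show "J * (b - a) / 8 \<le> (f a + f b)/2 - 1/(b - a) * integral {a..b} f"
    by argo
qed

section \<open>Sharpness: the distance to the midpoint\<close>

lemma right_deriv_dist: "right_deriv (dist m) m = 1"
proof (rule right_deriv_eqI)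
  have "eventually (\<lambda>y. m < y) (at_right m)" by (rule eventually_at_right_less)
  then show "(dist m has_real_derivative 1) (at_right m)"
    unfolding has_field_derivative_iff
    by (intro tendsto_eventually) (auto elim!: eventually_mono simp: dist_real_def)
qed

lemma left_deriv_dist: "left_deriv (dist m) m = - 1"
proof (rule left_deriv_eqI)
  have "eventually (\<lambda>y. y < m) (at_left m)" by (simp add: eventually_at_filter)
  then show "(dist m has_real_derivative - 1) (at_left m)"
    unfolding has_field_derivative_iff
    by (intro tendsto_eventually) (auto elim!: eventually_mono simp: dist_real_def field_simps)
qed

lemma integral_dist_midpoint:
  fixes a b :: real
  assumes "a < b"
  shows "integral {a..b} (dist ((a + b)/2)) = (b - a)\<^sup>2 / 4"
proof -
  define m where "m = (a + b) / 2"
  have m: "a \<le> m" "m \<le> b" using assms by (auto simp: m_def)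
  \<comment> \<open>On the left half the distance is \<open>(m - a) - (t - a)\<close>, on the right
    half \<open>t - m\<close>; both are affine.\<close>
  have "(dist m has_integral (m - a)\<^sup>2 / 2) {a..m}"
    using has_integral_affine[OF m(1), of "m - a" "- 1"]
    by (rule has_integral_eq_rhs[OF has_integral_eq, rotated])
      (auto simp: dist_real_def power2_eq_square field_simps)
  moreover have "(dist m has_integral (b - m)\<^sup>2 / 2) {m..b}"
    using has_integral_affine[OF m(2), of 0 1]
    by (rule has_integral_eq_rhs[OF has_integral_eq, rotated])
      (auto simp: dist_real_def power2_eq_square field_simps)
  ultimately have "(dist m has_integral ((m - a)\<^sup>2 / 2 + (b - m)\<^sup>2 / 2)) {a..b}"
    by (rule has_integral_combine[OF m])
  moreover have "(m - a)\<^sup>2 / 2 + (b - m)\<^sup>2 / 2 = (b - a)\<^sup>2 / 4"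
    by (simp add: m_def power2_eq_square field_simps)
  ultimately show ?thesis by (simp add: m_def integral_unique)
qed

theorem corollary1:
  fixes a b :: real
  assumes "a < b"
  shows "(\<forall>f :: real \<Rightarrow> real. convex_on {a..b} f \<longrightarrow>
            0 \<le> 1/8 * (right_deriv f ((a + b)/2) - left_deriv f ((a + b)/2)) * (b - a) \<and>
            1/8 * (right_deriv f ((a + b)/2) - left_deriv f ((a + b)/2)) * (b - a)
              \<le> (f a + f b)/2 - 1/(b - a) * integral {a..b} f) \<and>
         (\<forall>c > 1/8. \<not> (\<forall>f :: real \<Rightarrow> real. convex_on {a..b} f \<longrightarrow>
            c * (right_deriv f ((a + b)/2) - left_deriv f ((a + b)/2)) * (b - a)
              \<le> (f a + f b)/2 - 1/(b - a) * integral {a..b} f))"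
proof (intro conjI allI impI)
  fix f :: "real \<Rightarrow> real"
  assume f: "convex_on {a..b} f"
  note jump = trapezoid_error_ge_deriv_jump[OF f assms]
  show "0 \<le> 1/8 * (right_deriv f ((a + b)/2) - left_deriv f ((a + b)/2)) * (b - a)"
    using jump(1) assms by simp
  show "1/8 * (right_deriv f ((a + b)/2) - left_deriv f ((a + b)/2)) * (b - a)
      \<le> (f a + f b)/2 - 1/(b - a) * integral {a..b} f"
    using jump(2) by simp
next
  fix c :: real
  assume c: "1/8 < c"
  \<comment> \<open>Its derivative jumps by 2 at the midpoint, so the left side is
    \<open>2 * c * (b - a)\<close>, while the right side is \<open>(b - a)/4\<close>: equality
    exactly at \<open>c = 1/8\<close>.\<close>
  let ?f = "dist ((a + b)/2)"
  have "(?f a + ?f b)/2 = (b - a)/2"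
    using assms by (simp add: dist_real_def field_simps)
  moreover have "1/(b - a) * integral {a..b} ?f = (b - a)/4"
    using assms by (simp add: integral_dist_midpoint power2_eq_square)
  moreover have "(b - a)/4 < c * (right_deriv ?f ((a + b)/2) - left_deriv ?f ((a + b)/2)) * (b - a)"
    using c assms mult_strict_right_mono[of "1/8" c "2 * (b - a)"]
    by (simp add: right_deriv_dist left_deriv_dist)
  ultimately have "\<not> c * (right_deriv ?f ((a + b)/2) - left_deriv ?f ((a + b)/2)) * (b - a)
      \<le> (?f a + ?f b)/2 - 1/(b - a) * integral {a..b} ?f"
    by linarith
  moreover have "convex_on {a..b} ?f" by (rule convex_on_dist) simp
  ultimately show "\<not> (\<forall>f :: real \<Rightarrow> real. convex_on {a..b} f \<longrightarrow>
      c * (right_deriv f ((a + b)/2) - left_deriv f ((a + b)/2)) * (b - a)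
        \<le> (f a + f b)/2 - 1/(b - a) * integral {a..b} f)"
    by blast
qed

end
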